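(* If $R\subset S$ is an integral FCP extension of commutative rings, then $({}_S^uR)({}_S^+R)={}_S^tR$ (the left-hand side being the compositum, i.e. the subring of $S$ generated by ${}_S^uR$ and ${}_S^+R$). In particular, such an extension is t-closed if and only if it is seminormal and u-closed (anodal).
   Context: All rings are commutative and unital; $\subset$ denotes proper inclusion. $[R,S]$ is the set of all $R$-subalgebras of $S$, ordered by inclusion; $R\subseteq S$ has FCP if each chain in $[R,S]$ is finite. An extension $R\subseteq S$ is seminormal (s-closed) if $b\in S$ lies in $R$ whenever $b^2,b^3\in R$; u-closed (anodal) if $b\in S$ lies in $R$ whenever $b^2-b,\,b^3-b^2\in R$; t-closed if $b\in S$ lies in $R$ whenever $b^2-rb,\,b^3-rb^2\in R$ for some $r\in R$. The seminormalization ${}_S^+R$ (resp. u-closure ${}_S^uR$; t-closure ${}_S^tR$) is the smallest $B\in[R,S]$ such that $B\subseteq S$ is seminormal (resp. u-closed; t-closed). Equivalently, ${}_S^+R$ (resp. ${}_S^tR$) is the greatest $B\in[R,S]$ such that $R\subseteq B$ is subintegral (resp. infra-integral), where an integral extension is infra-integral if all its residual field extensions are isomorphisms, and subintegral if moreover the map on spectra is injective. *)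

theory Defs
  imports "HOL-Algebra.Algebra"
begin

text \<open>
  A ring extension \<open>R \<subseteq> S\<close> is a commutative ring \<open>S\<close> (a record) together with the underlying
  set \<open>R\<close> of a unital subring of it.  An \<open>R\<close>-subalgebra of \<open>S\<close> is then a unital subring of
  \<open>S\<close> containing \<open>R\<close>.  The locale \<open>subalgebra\<close> of the library is not this notion: it
  asks neither for the unit nor for closure under multiplication.
\<close>

definition intermediate_rings :: "'a set \<Rightarrow> ('a, 'm) ring_scheme \<Rightarrow> 'a set set" where
  "intermediate_rings R S = {T. subring T S \<and> R \<subseteq> T}"

definition FCP :: "'a set \<Rightarrow> ('a, 'm) ring_scheme \<Rightarrow> bool" where
  "FCP R S \<longleftrightarrow> (\<forall>C. subset.chain (intermediate_rings R S) C \<longrightarrow> finite C)"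

definition integral_over :: "'a set \<Rightarrow> ('a, 'm) ring_scheme \<Rightarrow> 'a \<Rightarrow> bool" where
  "integral_over R S x \<longleftrightarrow>
     (\<exists>(n::nat) a. (\<forall>i<n. a i \<in> R) \<and>
        x [^]\<^bsub>S\<^esub> n \<oplus>\<^bsub>S\<^esub> (\<Oplus>\<^bsub>S\<^esub>i\<in>{..<n}. a i \<otimes>\<^bsub>S\<^esub> x [^]\<^bsub>S\<^esub> i) = \<zero>\<^bsub>S\<^esub>)"

definition integral_extension :: "'a set \<Rightarrow> ('a, 'm) ring_scheme \<Rightarrow> bool" where
  "integral_extension R S \<longleftrightarrow> (\<forall>x\<in>carrier S. integral_over R S x)"

definition seminormal :: "'a set \<Rightarrow> ('a, 'm) ring_scheme \<Rightarrow> bool" where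
  "seminormal R S \<longleftrightarrow>
     (\<forall>b\<in>carrier S. b [^]\<^bsub>S\<^esub> (2::nat) \<in> R \<and> b [^]\<^bsub>S\<^esub> (3::nat) \<in> R \<longrightarrow> b \<in> R)"

definition u_closed :: "'a set \<Rightarrow> ('a, 'm) ring_scheme \<Rightarrow> bool" where
  "u_closed R S \<longleftrightarrow>
     (\<forall>b\<in>carrier S. b [^]\<^bsub>S\<^esub> (2::nat) \<ominus>\<^bsub>S\<^esub> b \<in> R \<and>
        b [^]\<^bsub>S\<^esub> (3::nat) \<ominus>\<^bsub>S\<^esub> b [^]\<^bsub>S\<^esub> (2::nat) \<in> R \<longrightarrow> b \<in> R)"

definition t_closed :: "'a set \<Rightarrow> ('a, 'm) ring_scheme \<Rightarrow> bool" where
  "t_closed R S \<longleftrightarrow>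
     (\<forall>b\<in>carrier S. (\<exists>r\<in>R. b [^]\<^bsub>S\<^esub> (2::nat) \<ominus>\<^bsub>S\<^esub> r \<otimes>\<^bsub>S\<^esub> b \<in> R \<and>
        b [^]\<^bsub>S\<^esub> (3::nat) \<ominus>\<^bsub>S\<^esub> r \<otimes>\<^bsub>S\<^esub> b [^]\<^bsub>S\<^esub> (2::nat) \<in> R) \<longrightarrow> b \<in> R)"

text \<open>Least elements with respect to inclusion; their existence is proved below.\<close>

definition seminormalization :: "'a set \<Rightarrow> ('a, 'm) ring_scheme \<Rightarrow> 'a set" where
  "seminormalization R S = (LEAST B. B \<in> intermediate_rings R S \<and> seminormal B S)"

definition u_closure :: "'a set \<Rightarrow> ('a, 'm) ring_scheme \<Rightarrow> 'a set" where
  "u_closure R S = (LEAST B. B \<in> intermediate_rings R S \<and> u_closed B S)"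

definition t_closure :: "'a set \<Rightarrow> ('a, 'm) ring_scheme \<Rightarrow> 'a set" where
  "t_closure R S = (LEAST B. B \<in> intermediate_rings R S \<and> t_closed B S)"

definition compositum :: "('a, 'm) ring_scheme \<Rightarrow> 'a set \<Rightarrow> 'a set \<Rightarrow> 'a set" where
  "compositum S A B = generate_ring S (A \<union> B)"

lemma least_intermediate_ring:
  assumes "ring S" "R \<subseteq> carrier S" "P (carrier S)"
    and "\<And>F. \<forall>B\<in>F. P B \<Longrightarrow> P (\<Inter>F)"
  defines "L \<equiv> (LEAST B. B \<in> intermediate_rings R S \<and> P B)"
  shows "L \<in> intermediate_rings R S" "P L"
    "\<And>B. \<lbrakk>B \<in> intermediate_rings R S; P B\<rbrakk> \<Longrightarrow> L \<subseteq> B"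
proof -
  interpret ring S by fact
  define F where "F = {B \<in> intermediate_rings R S. P B}"
  have "carrier S \<in> F"
    using assms(2,3) carrier_is_subring by (auto simp: F_def intermediate_rings_def)
  then have ne: "F \<noteq> {}" by blast
  have "subring (\<Inter>F) S"
    by (rule subring_Inter[OF _ ne]) (auto simp: F_def intermediate_rings_def)
  then have I: "\<Inter>F \<in> intermediate_rings R S"
    by (auto simp: F_def intermediate_rings_def)
  have PI: "P (\<Inter>F)" by (rule assms(4)) (simp add: F_def)
  have L: "L = \<Inter>F"
    unfolding L_def by (rule Least_equality) (use I PI in \<open>auto simp: F_def\<close>)
  show "L \<in> intermediate_rings R S" "P L" using I PI L by auto
  show "\<And>B. \<lbrakk>B \<in> intermediate_rings R S; P B\<rbrakk> \<Longrightarrow> L \<subseteq> B"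
    unfolding L by (auto simp: F_def)
qed

lemma
  assumes "ring S" "R \<subseteq> carrier S"
  shows seminormalization_intermediate: "seminormalization R S \<in> intermediate_rings R S"
    and seminormalization_seminormal: "seminormal (seminormalization R S) S"
    and seminormalization_least:
      "\<lbrakk>B \<in> intermediate_rings R S; seminormal B S\<rbrakk> \<Longrightarrow> seminormalization R S \<subseteq> B"
proof -
  have 1: "seminormal (carrier S) S" by (simp add: seminormal_def)
  have 2: "seminormal (\<Inter>F) S" if "\<forall>B\<in>F. seminormal B S" for F
    using that unfolding seminormal_def by blast
  show "seminormalization R S \<in> intermediate_rings R S"
    unfolding seminormalization_def by (rule least_intermediate_ring(1)[OF assms]) (fact 1, rule 2)
  show "seminormal (seminormalization R S) S"
    unfolding seminormalization_def by (rule least_intermediate_ring(2)[OF assms]) (fact 1, rule 2)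
  show "seminormalization R S \<subseteq> B" if "B \<in> intermediate_rings R S" "seminormal B S"
    unfolding seminormalization_def
    by (rule least_intermediate_ring(3)[where P = "\<lambda>B. seminormal B S", OF assms 1 _ that]) (rule 2)
qed

lemma
  assumes "ring S" "R \<subseteq> carrier S"
  shows u_closure_intermediate: "u_closure R S \<in> intermediate_rings R S"
    and u_closure_u_closed: "u_closed (u_closure R S) S"
    and u_closure_least:
      "\<lbrakk>B \<in> intermediate_rings R S; u_closed B S\<rbrakk> \<Longrightarrow> u_closure R S \<subseteq> B"
proof -
  have 1: "u_closed (carrier S) S" by (simp add: u_closed_def)
  have 2: "u_closed (\<Inter>F) S" if "\<forall>B\<in>F. u_closed B S" for F
    using that unfolding u_closed_def by blast
  show "u_closure R S \<in> intermediate_rings R S"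
    unfolding u_closure_def by (rule least_intermediate_ring(1)[OF assms]) (fact 1, rule 2)
  show "u_closed (u_closure R S) S"
    unfolding u_closure_def by (rule least_intermediate_ring(2)[OF assms]) (fact 1, rule 2)
  show "u_closure R S \<subseteq> B" if "B \<in> intermediate_rings R S" "u_closed B S"
    unfolding u_closure_def
    by (rule least_intermediate_ring(3)[where P = "\<lambda>B. u_closed B S", OF assms 1 _ that]) (rule 2)
qed

lemma
  assumes "ring S" "R \<subseteq> carrier S"
  shows t_closure_intermediate: "t_closure R S \<in> intermediate_rings R S"
    and t_closure_t_closed: "t_closed (t_closure R S) S"
    and t_closure_least:
      "\<lbrakk>B \<in> intermediate_rings R S; t_closed B S\<rbrakk> \<Longrightarrow> t_closure R S \<subseteq> B"
proof -
  have 1: "t_closed (carrier S) S" by (simp add: t_closed_def)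
  have 2: "t_closed (\<Inter>F) S" if *: "\<forall>B\<in>F. t_closed B S" for F
    unfolding t_closed_def
  proof (intro ballI impI InterI)
    fix b B assume b: "b \<in> carrier S" and B: "B \<in> F"
      and "\<exists>r\<in>\<Inter>F. b [^]\<^bsub>S\<^esub> (2::nat) \<ominus>\<^bsub>S\<^esub> r \<otimes>\<^bsub>S\<^esub> b \<in> \<Inter>F \<and>
        b [^]\<^bsub>S\<^esub> (3::nat) \<ominus>\<^bsub>S\<^esub> r \<otimes>\<^bsub>S\<^esub> b [^]\<^bsub>S\<^esub> (2::nat) \<in> \<Inter>F"
    then have "\<exists>r\<in>B. b [^]\<^bsub>S\<^esub> (2::nat) \<ominus>\<^bsub>S\<^esub> r \<otimes>\<^bsub>S\<^esub> b \<in> B \<and>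
        b [^]\<^bsub>S\<^esub> (3::nat) \<ominus>\<^bsub>S\<^esub> r \<otimes>\<^bsub>S\<^esub> b [^]\<^bsub>S\<^esub> (2::nat) \<in> B" by blast
    with b B * show "b \<in> B" unfolding t_closed_def by blast
  qed
  show "t_closure R S \<in> intermediate_rings R S"
    unfolding t_closure_def by (rule least_intermediate_ring(1)[OF assms]) (fact 1, rule 2)
  show "t_closed (t_closure R S) S"
    unfolding t_closure_def by (rule least_intermediate_ring(2)[OF assms]) (fact 1, rule 2)
  show "t_closure R S \<subseteq> B" if "B \<in> intermediate_rings R S" "t_closed B S"
    unfolding t_closure_def
    by (rule least_intermediate_ring(3)[where P = "\<lambda>B. t_closed B S", OF assms 1 _ that]) (rule 2)
qed

end

theory Submission
  imports Defs
begin

text \<open>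
  Let \<open>T\<close> be the t-closure of \<open>R\<close> in \<open>S\<close>, \<open>J\<close> the conductor of \<open>R\<close> in \<open>T\<close>, and \<open>N\<close> the radical of
  \<open>J\<close> in \<open>T\<close>. The ring \<open>T\<close> is reached from \<open>R\<close> by finitely many steps \<open>A \<subset> A + A b\<close> with \<open>b\<^sup>2 - r b\<close> and
  \<open>b (b\<^sup>2 - r b)\<close> in \<open>A\<close>. For \<open>a \<in> A\<close> the chain of rings \<open>A + a\<^sup>n b A\<close> is stationary; going down the
  steps, this shows that \<open>W / (W \<inter> N)\<close> is von Neumann regular for every ring \<open>W\<close> between \<open>R\<close> and \<open>T\<close>.
  Elements nilpotent modulo \<open>J\<close> lie in the seminormalization and elements idempotent modulo \<open>J\<close>
  lie in the u-closure, so the compositum contains \<open>N\<close> and, by lifting idempotents, every element of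
  \<open>T\<close> that is idempotent modulo \<open>N\<close>. If \<open>b\<^sup>2 - r b = c\<close> with \<open>r\<close>, \<open>c\<close> and \<open>b c\<close> in the compositum, then
  regularity splits off \<open>b\<close> a part where \<open>c\<close> is invertible, a part where \<open>r\<close> is zero and \<open>b\<close> is
  nilpotent, and a part where \<open>r\<close> is invertible and \<open>b / r\<close> is idempotent (all modulo \<open>N\<close>); hence the
  compositum is t-closed.
\<close>

section \<open>Sequences of intermediate rings under FCP\<close>

text \<open>Strictness makes \<open>f\<close> injective and comparability makes its range a chain,
  which would be infinite. The direction of the inclusions is left open to serve ascending and
  descending sequences alike.\<close>

lemma FCP_strict_sequence_False:
  assumes "FCP R S" and "\<And>i::nat. f i \<in> intermediate_rings R S"
    and "\<And>i j. i < j \<Longrightarrow> f i \<subset> f j \<or> f j \<subset> f i"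
  shows False
proof -
  have "f i \<subseteq> f j \<or> f j \<subseteq> f i" for i j
    using assms(3)[of i j] assms(3)[of j i] by (cases i j rule: linorder_cases) auto
  then have "subset.chain (intermediate_rings R S) (range f)"
    using assms(2) by (fastforce simp: subset_chain_def)
  then have "finite (range f)" using assms(1) by (simp add: FCP_def)
  moreover have "inj f"
  proof (rule injI)
    fix i j assume "f i = f j"
    then show "i = j"
      using assms(3)[of i j] assms(3)[of j i] by (cases i j rule: linorder_cases) auto
  qed
  ultimately show False using finite_imageD by blast
qed

lemma FCP_antimono_stationary:
  assumes "FCP R S" and "\<And>i::nat. D i \<in> intermediate_rings R S"
    and "\<And>i. D (Suc i) \<subseteq> D i"
  shows "\<exists>n. D n \<subseteq> D (Suc n)"
proof (rule ccontr)
  assume "\<nexists>n. D n \<subseteq> D (Suc n)"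
  then have strict: "D (Suc i) \<subset> D i" for i using assms(3) by blast
  have "D j \<subset> D i" if "i < j" for i j
    using that
  proof (rule less_Suc_induct)
    show "D (Suc i) \<subset> D i" for i by (fact strict)
    show "D k \<subset> D i" if "D j \<subset> D i" "D k \<subset> D j" for i j k
      using that by (rule psubset_trans[rotated])
  qed
  then show False by (intro FCP_strict_sequence_False[OF assms(1,2)] disjI2)
qed

text \<open>Larger rings come first in this relation, so well-founded induction may assume a claim
  for every larger intermediate ring.\<close>

lemma FCP_wf:
  assumes "FCP R S"
  shows "wf {(B, A). A \<in> intermediate_rings R S \<and> B \<in> intermediate_rings R S \<and> A \<subset> B}"
  unfolding wf_iff_no_infinite_down_chain
proof (rule notI, elim exE)
  fix f :: "nat \<Rightarrow> 'a set"
  assume f: "\<forall>i. (f (Suc i), f i) \<in>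
    {(B, A). A \<in> intermediate_rings R S \<and> B \<in> intermediate_rings R S \<and> A \<subset> B}"
  have "f i \<subset> f j" if "i < j" for i j
    by (rule lift_Suc_mono_less[OF _ that]) (use f in simp)
  then show False using f by (intro FCP_strict_sequence_False[OF assms, of f] disjI1) simp_all
qed

context cring
begin

section \<open>Ideals, radicals and conductors inside a subring\<close>

text \<open>Kept as plain subsets, since ideals of many subrings are compared under the same
  operations. Closure under negation is multiplication by \<open>\<ominus> \<one>\<close>, which
  lies in \<open>T\<close> when \<open>T\<close> is a subring.\<close>

definition ideal_in :: "'a set \<Rightarrow> 'a set \<Rightarrow> bool" where
  "ideal_in T I \<longleftrightarrow> I \<subseteq> T \<and> \<zero> \<in> I \<and> (\<forall>x\<in>I. \<forall>y\<in>I. x \<oplus> y \<in> I) \<and> (\<forall>x\<in>I. \<forall>y\<in>T. x \<otimes> y \<in> I)"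

definition radical_in :: "'a set \<Rightarrow> 'a set \<Rightarrow> 'a set" where
  "radical_in T I = {x \<in> T. \<exists>n::nat. x [^] n \<in> I}"

definition conductor :: "'a set \<Rightarrow> 'a set \<Rightarrow> 'a set" where
  "conductor A T = {x \<in> A. \<forall>y\<in>T. x \<otimes> y \<in> A}"

lemma subring_closed:
  assumes "subring T R"
  shows "T \<subseteq> carrier R" "\<zero> \<in> T" "\<one> \<in> T"
    "x \<in> T \<Longrightarrow> x \<in> carrier R"
    "x \<in> T \<Longrightarrow> y \<in> T \<Longrightarrow> x \<oplus> y \<in> T" "x \<in> T \<Longrightarrow> y \<in> T \<Longrightarrow> x \<otimes> y \<in> T"
    "x \<in> T \<Longrightarrow> \<ominus> x \<in> T" "x \<in> T \<Longrightarrow> y \<in> T \<Longrightarrow> x \<ominus> y \<in> T"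
    "x \<in> T \<Longrightarrow> x [^] (n::nat) \<in> T"
proof -
  show "T \<subseteq> carrier R" "\<zero> \<in> T" "\<one> \<in> T" "x \<in> T \<Longrightarrow> x \<in> carrier R"
    using subringE(1-3)[OF assms] by auto
  show "x \<in> T \<Longrightarrow> y \<in> T \<Longrightarrow> x \<oplus> y \<in> T" "x \<in> T \<Longrightarrow> y \<in> T \<Longrightarrow> x \<otimes> y \<in> T"
    "x \<in> T \<Longrightarrow> \<ominus> x \<in> T" "x \<in> T \<Longrightarrow> y \<in> T \<Longrightarrow> x \<ominus> y \<in> T"
    using subringE(5-7)[OF assms] by (simp_all add: a_minus_def)
  show "x \<in> T \<Longrightarrow> x [^] n \<in> T"
    using subringE(3,6)[OF assms] by (induction n) simp_all
qed

lemma ideal_in_closed: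
  assumes "subring T R" "ideal_in T I"
  shows "\<zero> \<in> I" "x \<in> I \<Longrightarrow> x \<in> T" "x \<in> I \<Longrightarrow> x \<in> carrier R"
    "x \<in> I \<Longrightarrow> y \<in> I \<Longrightarrow> x \<oplus> y \<in> I" "x \<in> I \<Longrightarrow> y \<in> T \<Longrightarrow> x \<otimes> y \<in> I"
    "x \<in> I \<Longrightarrow> y \<in> T \<Longrightarrow> y \<otimes> x \<in> I" "x \<in> I \<Longrightarrow> \<ominus> x \<in> I"
    "x \<in> I \<Longrightarrow> y \<in> I \<Longrightarrow> x \<ominus> y \<in> I"
proof -
  note T = subring_closed[OF assms(1)]
  show 0: "\<zero> \<in> I" and 1: "\<And>x. x \<in> I \<Longrightarrow> x \<in> T"
    and 2: "\<And>x y. x \<in> I \<Longrightarrow> y \<in> I \<Longrightarrow> x \<oplus> y \<in> I"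
    and 3: "\<And>x y. x \<in> I \<Longrightarrow> y \<in> T \<Longrightarrow> x \<otimes> y \<in> I"
    using assms(2) by (auto simp: ideal_in_def)
  show 4: "\<And>x. x \<in> I \<Longrightarrow> x \<in> carrier R" using 1 T(4) by simp
  show "y \<otimes> x \<in> I" if "x \<in> I" "y \<in> T" for x y
    using 3[OF that] m_comm[OF 4[OF that(1)] T(4)[OF that(2)]] by simp
  show 5: "\<ominus> x \<in> I" if "x \<in> I" for x
    using 3[of x "\<ominus> \<one>"] T(3,7) that 4 by (simp add: r_minus)
  show "x \<ominus> y \<in> I" if "x \<in> I" "y \<in> I" for x y
    using 2 5 that by (simp add: a_minus_def)
qed

lemma ideal_in_radical:
  assumes T: "subring T R" and I: "ideal_in T I"
  shows "ideal_in T (radical_in T I)"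
  unfolding ideal_in_def
proof (intro conjI ballI)
  note T' = subring_closed[OF T] and I' = ideal_in_closed[OF T I]
  show "radical_in T I \<subseteq> T" by (auto simp: radical_in_def)
  have "\<zero> [^] (1::nat) \<in> I" using I' by simp
  then show "\<zero> \<in> radical_in T I" using T' unfolding radical_in_def by blast
next
  note T' = subring_closed[OF T] and I' = ideal_in_closed[OF T I]
  fix x y assume "x \<in> radical_in T I" and y: "y \<in> T"
  then obtain n :: nat where x: "x \<in> T" "x [^] n \<in> I" by (auto simp: radical_in_def)
  have "(x \<otimes> y) [^] n = x [^] n \<otimes> y [^] n" using x y T' by (simp add: nat_pow_distrib)
  then have "(x \<otimes> y) [^] n \<in> I" using x y T' I' by simp
  then show "x \<otimes> y \<in> radical_in T I" using x y T' by (auto simp: radical_in_def)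
next
  note T' = subring_closed[OF T] and I' = ideal_in_closed[OF T I]
  fix x y assume "x \<in> radical_in T I" "y \<in> radical_in T I"
  then obtain n m :: nat where x: "x \<in> T" "x [^] n \<in> I" and y: "y \<in> T" "y [^] m \<in> I"
    by (auto simp: radical_in_def)
  have c: "x \<in> carrier R" "y \<in> carrier R" using x y T' by auto
  have hi: "z [^] i \<in> I" if "z \<in> T" "z [^] l \<in> I" "l \<le> i" for z and l i :: nat
  proof -
    have "z [^] i = z [^] l \<otimes> z [^] (i - l)" using that T' by (simp add: nat_pow_mult)
    then show ?thesis using that T' I' by simp
  qed
  \<comment> \<open>In place of the binomial theorem, the factors \<open>x \<oplus> y\<close> are
    expanded one at a time; with none left, one of the exponents of \<open>x\<close> and
    \<open>y\<close> is large enough.\<close>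
  have "n + m \<le> i + j + k \<Longrightarrow> x [^] i \<otimes> y [^] j \<otimes> (x \<oplus> y) [^] k \<in> I" for i j k :: nat
  proof (induction k arbitrary: i j)
    case 0
    then have "n \<le> i \<or> m \<le> j" by linarith
    then have "x [^] i \<in> I \<or> y [^] j \<in> I" using hi x y by blast
    then have "x [^] i \<otimes> y [^] j \<in> I" using I'(5)[of "x [^] i" "y [^] j"] I'(6)[of "y [^] j" "x [^] i"] T'(9) x(1) y(1) by blast
    then show ?case using c by simp
  next
    case (Suc k)
    have "x [^] i \<otimes> y [^] j \<otimes> (x \<oplus> y) [^] Suc k =
      x [^] Suc i \<otimes> y [^] j \<otimes> (x \<oplus> y) [^] k \<oplus> x [^] i \<otimes> y [^] Suc j \<otimes> (x \<oplus> y) [^] k"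
      using c nat_pow_closed by (simp add: l_distr r_distr m_ac)
    moreover have "x [^] Suc i \<otimes> y [^] j \<otimes> (x \<oplus> y) [^] k \<in> I" by (rule Suc.IH) (use Suc.prems in simp)
    moreover have "x [^] i \<otimes> y [^] Suc j \<otimes> (x \<oplus> y) [^] k \<in> I" by (rule Suc.IH) (use Suc.prems in simp)
    ultimately show ?case using I'(4) by simp
  qed
  from this[of 0 0 "n + m"] have "(x \<oplus> y) [^] (n + m) \<in> I" using c by simp
  then show "x \<oplus> y \<in> radical_in T I" using x y T' by (auto simp: radical_in_def)
qed

lemma radical_in_pow_imp:
  assumes "subring T R" "x \<in> T" "x [^] (n::nat) \<in> radical_in T I"
  shows "x \<in> radical_in T I"
proof -
  obtain m :: nat where "(x [^] n) [^] m \<in> I" using assms by (auto simp: radical_in_def)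
  then have "x [^] (n * m) \<in> I" using assms subring_closed(4)[OF assms(1)] by (simp add: nat_pow_pow)
  then show ?thesis using assms by (auto simp: radical_in_def)
qed

lemma radical_in_square_imp:
  assumes "subring T R" "x \<in> T" "x \<otimes> x \<in> radical_in T I"
  shows "x \<in> radical_in T I"
  using radical_in_pow_imp[of T x 2] assms subring_closed(4)[of T x] by (simp add: numeral_2_eq_2)

lemma subset_radical_in: "subring T R \<Longrightarrow> ideal_in T I \<Longrightarrow> I \<subseteq> radical_in T I"
proof
  fix x assume "subring T R" "ideal_in T I" "x \<in> I"
  then have "x [^] (1::nat) \<in> I" "x \<in> T" using ideal_in_closed[of T I] by auto
  then show "x \<in> radical_in T I" unfolding radical_in_def by blast
qed

lemma ideal_in_conductor:
  assumes A: "subring A R" and T: "subring T R" and "A \<subseteq> T"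
  shows "ideal_in T (conductor A T)"
proof -
  note A' = subring_closed[OF A] and T' = subring_closed[OF T]
  have mult: "x \<otimes> y \<in> conductor A T" if "x \<in> conductor A T" "y \<in> T" for x y
  proof -
    have "x \<otimes> y \<otimes> z \<in> A" if z: "z \<in> T" for z
      using \<open>x \<in> conductor A T\<close> \<open>y \<in> T\<close> z A' T' by (simp add: conductor_def m_assoc)
    then show ?thesis using that by (simp add: conductor_def)
  qed
  have "x \<oplus> y \<in> conductor A T" if "x \<in> conductor A T" "y \<in> conductor A T" for x y
    using that A' T' by (auto simp: conductor_def l_distr)
  moreover have "\<zero> \<in> conductor A T" using A' T' by (simp add: conductor_def)
  moreover have "conductor A T \<subseteq> T" using assms(3) by (auto simp: conductor_def)
  ultimately show ?thesis using mult by (simp add: ideal_in_def)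
qed

section \<open>Elementary steps and the rings \<open>A + A b\<close>\<close>

text \<open>The condition of t-closedness for a single pair \<open>r\<close>, \<open>b\<close>, with
  \<open>b^3 - r b^2\<close> written as \<open>b (b^2 - r b)\<close>. For a subring \<open>A\<close>
  it makes \<open>A + A b\<close> a ring and puts \<open>b^2 - r b\<close> into the
  conductor.\<close>

definition t_step :: "'a set \<Rightarrow> 'a \<Rightarrow> 'a \<Rightarrow> bool" where
  "t_step A r b \<longleftrightarrow> b \<in> carrier R \<and> r \<in> A \<and> b \<otimes> b \<ominus> r \<otimes> b \<in> A \<and> b \<otimes> (b \<otimes> b \<ominus> r \<otimes> b) \<in> A"

lemma t_closed_iff:
  assumes "A \<subseteq> carrier R"
  shows "t_closed A R \<longleftrightarrow> (\<forall>b r. t_step A r b \<longrightarrow> b \<in> A)"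
proof -
  have "b [^] (2::nat) \<ominus> r \<otimes> b \<in> A \<and> b [^] (3::nat) \<ominus> r \<otimes> b [^] (2::nat) \<in> A
      \<longleftrightarrow> t_step A r b" if b: "b \<in> carrier R" and r: "r \<in> A" for b r
  proof -
    have rc: "r \<in> carrier R" using r assms by auto
    have "b \<otimes> b \<otimes> b \<ominus> r \<otimes> (b \<otimes> b) = b \<otimes> (b \<otimes> b \<ominus> r \<otimes> b)" using b rc by algebra
    then show ?thesis using b r rc by (simp add: t_step_def numeral_eq_Suc)
  qed
  then have "t_closed A R \<longleftrightarrow> (\<forall>b\<in>carrier R. (\<exists>r\<in>A. t_step A r b) \<longrightarrow> b \<in> A)"
    unfolding t_closed_def by simp
  then show ?thesis unfolding t_step_def by blast
qed

lemma t_step_mono: "t_step A r b \<Longrightarrow> A \<subseteq> B \<Longrightarrow> t_step B r b"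
  by (auto simp: t_step_def)

definition adjoin :: "'a set \<Rightarrow> 'a \<Rightarrow> 'a set" where
  "adjoin A b = {p \<oplus> q \<otimes> b | p q. p \<in> A \<and> q \<in> A}"

lemma adjoinI: "p \<in> A \<Longrightarrow> q \<in> A \<Longrightarrow> p \<oplus> q \<otimes> b \<in> adjoin A b"
  by (auto simp: adjoin_def)

lemma subset_adjoin:
  assumes "subring A R" "b \<in> carrier R"
  shows "A \<subseteq> adjoin A b" "b \<in> adjoin A b"
proof -
  note A' = subring_closed[OF assms(1)]
  show "A \<subseteq> adjoin A b"
  proof
    fix p assume "p \<in> A"
    then show "p \<in> adjoin A b" using adjoinI[of p A "\<zero>" b] assms A' by simp
  qed
  show "b \<in> adjoin A b" using adjoinI[of "\<zero>" A "\<one>" b] assms A' by simp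
qed

lemma adjoin_least:
  assumes "subring T R" "A \<subseteq> T" "b \<in> T"
  shows "adjoin A b \<subseteq> T"
proof
  fix x assume "x \<in> adjoin A b"
  then obtain p q where "x = p \<oplus> q \<otimes> b" "p \<in> T" "q \<in> T" using assms by (auto simp: adjoin_def)
  then show "x \<in> T" using assms subring_closed[OF assms(1)] by simp
qed

lemma subring_adjoin:
  assumes A: "subring A R" and b: "b \<in> carrier R" and sq: "b \<otimes> b \<in> adjoin A b"
  shows "subring (adjoin A b) R"
proof (rule subringI)
  note A' = subring_closed[OF A]
  show "adjoin A b \<subseteq> carrier R" using A' b by (auto simp: adjoin_def)
  show "\<one> \<in> adjoin A b" using subset_adjoin[OF A b] A' by auto
next
  note A' = subring_closed[OF A]
  fix x assume "x \<in> adjoin A b"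
  then obtain p q where x: "x = p \<oplus> q \<otimes> b" "p \<in> A" "q \<in> A" by (auto simp: adjoin_def)
  have "p \<in> carrier R" "q \<in> carrier R" using x A' by auto
  then have "\<ominus> x = \<ominus> p \<oplus> (\<ominus> q) \<otimes> b" using x(1) b by algebra
  then show "\<ominus> x \<in> adjoin A b" using x A' by (metis adjoinI)
next
  note A' = subring_closed[OF A]
  fix x y assume "x \<in> adjoin A b" "y \<in> adjoin A b"
  then obtain p q p' q' where x: "x = p \<oplus> q \<otimes> b" "p \<in> A" "q \<in> A"
    and y: "y = p' \<oplus> q' \<otimes> b" "p' \<in> A" "q' \<in> A" by (auto simp: adjoin_def)
  obtain u v where uv: "b \<otimes> b = u \<oplus> v \<otimes> b" "u \<in> A" "v \<in> A" using sq by (auto simp: adjoin_def)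
  have c: "p \<in> carrier R" "q \<in> carrier R" "p' \<in> carrier R" "q' \<in> carrier R"
    "u \<in> carrier R" "v \<in> carrier R"
    using x y uv A' by auto
  have "x \<oplus> y = (p \<oplus> p') \<oplus> (q \<oplus> q') \<otimes> b" using x(1) y(1) b c by algebra
  then show "x \<oplus> y \<in> adjoin A b" using x y A' by (metis adjoinI)
  have "x \<otimes> y = p \<otimes> p' \<oplus> (p \<otimes> q' \<oplus> q \<otimes> p') \<otimes> b \<oplus> q \<otimes> q' \<otimes> (b \<otimes> b)"
    unfolding x(1) y(1) using b c by algebra
  also have "\<dots> = (p \<otimes> p' \<oplus> q \<otimes> q' \<otimes> u) \<oplus> (p \<otimes> q' \<oplus> q \<otimes> p' \<oplus> q \<otimes> q' \<otimes> v) \<otimes> b"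
    unfolding uv(1) using b c by algebra
  finally show "x \<otimes> y \<in> adjoin A b" using x y uv A' by (metis adjoinI)
qed

text \<open>Since \<open>1\<close> and \<open>b\<close> generate \<open>A + A b\<close> over
  \<open>A\<close>, multiplication by \<open>x\<close> is tested on these two.\<close>

lemma conductor_adjoinI:
  assumes "subring A R" "b \<in> carrier R" "x \<in> A" "x \<otimes> b \<in> A"
  shows "x \<in> conductor A (adjoin A b)"
proof -
  note A' = subring_closed[OF assms(1)]
  have "x \<otimes> (p \<oplus> q \<otimes> b) \<in> A" if "p \<in> A" "q \<in> A" for p q
  proof -
    have "p \<in> carrier R" "q \<in> carrier R" "x \<in> carrier R" using that assms A' by auto
    then have "x \<otimes> (p \<oplus> q \<otimes> b) = x \<otimes> p \<oplus> q \<otimes> (x \<otimes> b)" using assms(2) by algebra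
    then show ?thesis using that assms A' by simp
  qed
  then show ?thesis using assms(3) by (auto simp: conductor_def adjoin_def)
qed

text \<open>Multiples of \<open>b\<close> inherit a quadratic relation:
  \<open>(a b)^2 = a^2 c + (a r) (a b)\<close> with \<open>c = b^2 - r b\<close>.\<close>

lemma t_step_subring:
  assumes A: "subring A R" and "t_step A r b" "a \<in> A"
  shows "subring (adjoin A (a \<otimes> b)) R"
proof (rule subring_adjoin[OF A])
  note A' = subring_closed[OF A]
  define c where "c = b \<otimes> b \<ominus> r \<otimes> b"
  have c: "b \<in> carrier R" "a \<in> carrier R" "r \<in> carrier R" "c \<in> carrier R" "r \<in> A" "c \<in> A"
    using assms A' by (auto simp: t_step_def c_def)
  then show "a \<otimes> b \<in> carrier R" by simp
  have "(a \<otimes> b) \<otimes> (a \<otimes> b) = a \<otimes> a \<otimes> c \<oplus> (a \<otimes> r) \<otimes> (a \<otimes> b)" unfolding c_def using c by algebra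
  then show "(a \<otimes> b) \<otimes> (a \<otimes> b) \<in> adjoin A (a \<otimes> b)" using c assms(3) A' by (metis adjoinI)
qed

lemma t_step_adjoin:
  assumes A: "subring A R" and "t_step A r b"
  shows "subring (adjoin A b) R"
  using t_step_subring[OF assms subring_closed(3)[OF A]] assms(2) by (simp add: t_step_def)

section \<open>Regularity modulo the conductor of a single step\<close>

text \<open>The rings \<open>A + A a^n b\<close> decrease with \<open>n\<close>, and FCP makes two
  consecutive ones equal. Then \<open>a^n b = p + t a^(n+1) b\<close>, so
  \<open>a^n (1 - t a)\<close> carries \<open>b\<close> into \<open>A\<close> and lies in the
  conductor; this \<open>t\<close> is the witness.\<close>

lemma regular_mod_conductor_base:
  assumes fcp: "FCP B R" and A: "subring A R" "B \<subseteq> A" and step: "t_step A r b" and a: "a \<in> A"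
  shows "\<exists>t\<in>A. a \<otimes> (\<one> \<ominus> t \<otimes> a) \<in> radical_in (adjoin A b) (conductor A (adjoin A b))"
proof -
  note A' = subring_closed[OF A(1)]
  have c: "a \<in> carrier R" "b \<in> carrier R" using a step A' by (auto simp: t_step_def)
  define D where "D n = adjoin A (a [^] n \<otimes> b)" for n :: nat
  have D: "subring (D n) R" for n
    unfolding D_def using t_step_subring[OF A(1) step] a A' by simp
  have sub: "A \<subseteq> D n" "a [^] n \<otimes> b \<in> D n" for n
    unfolding D_def using subset_adjoin[OF A(1), of "a [^] n \<otimes> b"] c by auto
  have "D (Suc n) \<subseteq> D n" for n
  proof -
    have "a [^] Suc n \<otimes> b = a \<otimes> (a [^] n \<otimes> b)" using c by (simp add: m_ac)
    also have "\<dots> \<in> D n" using sub[of n] a subring_closed[OF D] by blast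
    finally show ?thesis
      unfolding D_def[of "Suc n"] by (intro adjoin_least[OF D] sub(1))
  qed
  moreover have "D n \<in> intermediate_rings B R" for n
    using D sub(1) A(2) by (auto simp: intermediate_rings_def)
  ultimately obtain n where "D n \<subseteq> D (Suc n)"
    using FCP_antimono_stationary[OF fcp, of D] by blast
  then have "a [^] n \<otimes> b \<in> adjoin A (a [^] Suc n \<otimes> b)" using sub(2)[of n] by (auto simp: D_def)
  then obtain p t where eq: "a [^] n \<otimes> b = p \<oplus> t \<otimes> (a [^] Suc n \<otimes> b)" and pt: "p \<in> A" "t \<in> A"
    by (auto simp: adjoin_def)
  define u where "u = a [^] n"
  have pc: "p \<in> carrier R" "t \<in> carrier R" "u \<in> carrier R" "u \<in> A"
    using pt A' a c by (auto simp: u_def)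
  have "u \<otimes> b = p \<oplus> t \<otimes> (u \<otimes> a \<otimes> b)" using eq by (simp add: u_def)
  moreover have "u \<otimes> (\<one> \<ominus> t \<otimes> a) \<otimes> b = u \<otimes> b \<ominus> t \<otimes> (u \<otimes> a \<otimes> b)" using c pc by algebra
  moreover have "p \<oplus> t \<otimes> (u \<otimes> a \<otimes> b) \<ominus> t \<otimes> (u \<otimes> a \<otimes> b) = p" using c pc by algebra
  ultimately have "u \<otimes> (\<one> \<ominus> t \<otimes> a) \<otimes> b \<in> A" using pt by simp
  then have K: "u \<otimes> (\<one> \<ominus> t \<otimes> a) \<in> conductor A (adjoin A b)"
    using conductor_adjoinI[OF A(1) c(2)] pc pt a A' by simp
  have T: "subring (adjoin A b) R" by (rule t_step_adjoin[OF A(1) step])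
  note Ab = subset_adjoin(1)[OF A(1) c(2)]
  have I: "ideal_in (adjoin A b) (conductor A (adjoin A b))"
    by (rule ideal_in_conductor[OF A(1) T Ab])
  define v where "v = \<one> \<ominus> t \<otimes> a"
  have v: "v \<in> A" "v \<in> carrier R" using pt a A' c pc by (auto simp: v_def)
  \<comment> \<open>The conductor element \<open>u v\<close> is completed to a full power of
    \<open>a v\<close> by the factor \<open>a v^n\<close>.\<close>
  have "(a \<otimes> v) [^] Suc n = u \<otimes> v \<otimes> (a \<otimes> v [^] n)"
    using c v by (simp add: nat_pow_distrib u_def m_ac)
  moreover have "a \<otimes> v [^] n \<in> A" "a \<otimes> v \<in> A" using A' a v by simp_all
  then have mem: "a \<otimes> v [^] n \<in> adjoin A b" "a \<otimes> v \<in> adjoin A b" using Ab by auto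
  ultimately have "(a \<otimes> v) [^] Suc n \<in> conductor A (adjoin A b)"
    using ideal_in_closed(5)[OF T I K[folded v_def] mem(1)] by metis
  then have "a \<otimes> v \<in> radical_in (adjoin A b) (conductor A (adjoin A b))"
    using mem(2) unfolding radical_in_def by blast
  then show ?thesis using pt(2) unfolding v_def by blast
qed

text \<open>Modulo the conductor of \<open>A \<subseteq> A[b]\<close> one has \<open>b (b - r) = 0\<close>, so an element \<open>p + q b\<close> is governed
  by its two specialisations \<open>p\<close> and \<open>p + q r\<close> at \<open>b = 0\<close> and \<open>b = r\<close>.\<close>

lemma regular_mod_conductor_step:
  assumes fcp: "FCP B R" and A: "subring A R" "B \<subseteq> A" and step: "t_step A r b"
    and W: "subring W R" "A \<subseteq> W" and j: "j \<in> adjoin A b" "j \<in> W"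
  shows "\<exists>s\<in>W. j \<otimes> (\<one> \<ominus> s \<otimes> j) \<in> radical_in (adjoin A b) (conductor A (adjoin A b))"
proof -
  define T where "T = adjoin A b"
  define N where "N = radical_in T (conductor A T)"
  define c where "c = b \<otimes> b \<ominus> r \<otimes> b"
  note A' = subring_closed[OF A(1)] and W' = subring_closed[OF W(1)]
  have b: "b \<in> carrier R" "r \<in> A" "c \<in> A" "b \<otimes> c \<in> A" using step by (auto simp: t_step_def c_def)
  have T: "subring T R" unfolding T_def by (rule t_step_adjoin[OF A(1) step])
  note T' = subring_closed[OF T]
  have AT: "A \<subseteq> T" "b \<in> T" unfolding T_def using subset_adjoin[OF A(1) b(1)] by auto
  have I: "ideal_in T (conductor A T)" by (rule ideal_in_conductor[OF A(1) T AT(1)])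
  have N: "ideal_in T N" unfolding N_def by (rule ideal_in_radical[OF T I])
  note N' = ideal_in_closed[OF T N]
  obtain p q where pq: "j = p \<oplus> q \<otimes> b" "p \<in> A" "q \<in> A" using j(1) by (auto simp: adjoin_def)
  define p' where "p' = p \<oplus> q \<otimes> r"
  have p': "p' \<in> A" using pq b A' by (simp add: p'_def)
  obtain t where t: "t \<in> A" "p \<otimes> (\<one> \<ominus> t \<otimes> p) \<in> N"
    using regular_mod_conductor_base[OF fcp A step pq(2)] by (auto simp: N_def T_def)
  obtain t' where t': "t' \<in> A" "p' \<otimes> (\<one> \<ominus> t' \<otimes> p') \<in> N"
    using regular_mod_conductor_base[OF fcp A step p'] by (auto simp: N_def T_def)
  have inT: "p \<in> T" "q \<in> T" "p' \<in> T" "t \<in> T" "t' \<in> T" "r \<in> T" "c \<in> T" "j \<in> T"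
    using pq p' t t' b AT j by (auto simp: T_def)
  have inC: "p \<in> carrier R" "q \<in> carrier R" "p' \<in> carrier R" "t \<in> carrier R" "t' \<in> carrier R"
    "r \<in> carrier R" "c \<in> carrier R" "j \<in> carrier R"
    using inT T' by auto
  have "c \<in> conductor A T"
    unfolding T_def using conductor_adjoinI[OF A(1) b(1,3)] b inC by (simp add: m_comm)
  then have cN: "c \<in> N" using subset_radical_in[OF T I] by (auto simp: N_def)
  \<comment> \<open>\<open>u\<close> and \<open>v\<close> are what \<open>j\<close> exceeds its two
    specialisations \<open>p\<close> and \<open>p'\<close> by; their product is
    \<open>q^2 c\<close>, which lies in \<open>N\<close>.\<close>
  define u where "u = q \<otimes> b"
  define v where "v = q \<otimes> (b \<ominus> r)"
  have uv: "u \<in> T" "v \<in> T" "u \<in> carrier R" "v \<in> carrier R"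
    using inT AT T' inC b by (auto simp: u_def v_def)
  have ju: "j = p \<oplus> u" using pq by (simp add: u_def)
  have jv: "j = p' \<oplus> v" unfolding pq(1) p'_def v_def using inC b(1) by algebra
  have "u \<otimes> v = q \<otimes> q \<otimes> c" unfolding u_def v_def c_def using inC b(1) by algebra
  then have uvN: "u \<otimes> v \<in> N" using cN N'(6) inT T' by simp
  define \<alpha> where "\<alpha> = \<one> \<ominus> t \<otimes> (p \<oplus> p \<oplus> u)"
  define \<beta> where "\<beta> = \<one> \<ominus> t' \<otimes> (p' \<oplus> p' \<oplus> v)"
  have ab: "\<alpha> \<in> T" "\<beta> \<in> T" "\<alpha> \<in> carrier R" "\<beta> \<in> carrier R"
    using inT uv T' by (auto simp: \<alpha>_def \<beta>_def)
  define g where "g = p \<otimes> (\<one> \<ominus> t \<otimes> p)"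
  define g' where "g' = p' \<otimes> (\<one> \<ominus> t' \<otimes> p')"
  have g: "g \<in> N" "g' \<in> N" "g \<in> carrier R" "g' \<in> carrier R"
    using t t' N' by (auto simp: g_def g'_def)
  \<comment> \<open>Modulo \<open>N\<close> this is a multiple of \<open>u\<close>, and its
    counterpart for \<open>t'\<close> a multiple of \<open>v\<close>, so the product of the two lies
    in \<open>N\<close>.\<close>
  have 1: "j \<otimes> (\<one> \<ominus> t \<otimes> j) = g \<oplus> u \<otimes> \<alpha>"
    unfolding ju g_def \<alpha>_def using inC uv by algebra
  have 2: "j \<otimes> (\<one> \<ominus> t' \<otimes> j) = g' \<oplus> v \<otimes> \<beta>"
    unfolding jv g'_def \<beta>_def using inC uv by algebra
  have "(g \<oplus> u \<otimes> \<alpha>) \<otimes> (g' \<oplus> v \<otimes> \<beta>) =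
      g \<otimes> (g' \<oplus> v \<otimes> \<beta>) \<oplus> g' \<otimes> (u \<otimes> \<alpha>) \<oplus> u \<otimes> v \<otimes> (\<alpha> \<otimes> \<beta>)"
    using g uv ab by algebra
  also have "\<dots> \<in> N"
    by (intro N'(4) N'(5)[OF g(1)] N'(5)[OF g(2)] N'(5)[OF uvN]) (use uv ab T' N'(2)[OF g(2)] in simp_all)
  finally have prodN: "j \<otimes> (\<one> \<ominus> t \<otimes> j) \<otimes> (j \<otimes> (\<one> \<ominus> t' \<otimes> j)) \<in> N" using 1 2 by simp
  define \<gamma> where "\<gamma> = \<one> \<ominus> t \<otimes> j"
  define \<delta> where "\<delta> = \<one> \<ominus> t' \<otimes> j"
  have gd: "\<gamma> \<in> T" "\<delta> \<in> T" "\<gamma> \<in> carrier R" "\<delta> \<in> carrier R"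
    using inT T' by (auto simp: \<gamma>_def \<delta>_def)
  have "j \<otimes> (\<gamma> \<otimes> \<delta>) \<otimes> (j \<otimes> (\<gamma> \<otimes> \<delta>)) = j \<otimes> \<gamma> \<otimes> (j \<otimes> \<delta>) \<otimes> (\<gamma> \<otimes> \<delta>)" using gd inC by algebra
  then have "j \<otimes> (\<gamma> \<otimes> \<delta>) \<otimes> (j \<otimes> (\<gamma> \<otimes> \<delta>)) \<in> N"
    using prodN N'(5) gd T' by (simp add: \<gamma>_def[symmetric] \<delta>_def[symmetric])
  moreover have "j \<otimes> (\<gamma> \<otimes> \<delta>) \<in> T" using gd inT T' by simp
  ultimately have N2: "j \<otimes> (\<gamma> \<otimes> \<delta>) \<in> N"
    unfolding N_def by (intro radical_in_square_imp[OF T, of "j \<otimes> (\<gamma> \<otimes> \<delta>)"])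
  \<comment> \<open>Read off from \<open>(1 - t j) (1 - t' j) = 1 - s j\<close>. It lies in
    \<open>W\<close> because \<open>t\<close>, \<open>t'\<close> and \<open>j\<close> do, even if
    \<open>b\<close> does not.\<close>
  define s where "s = t \<oplus> t' \<ominus> t \<otimes> t' \<otimes> j"
  have "t \<in> W" "t' \<in> W" using t t' W(2) by auto
  then have s: "s \<in> W" using j(2) W' by (simp add: s_def)
  have "\<gamma> \<otimes> \<delta> = \<one> \<ominus> s \<otimes> j" unfolding \<gamma>_def \<delta>_def s_def using inC by algebra
  then show ?thesis using s N2 by (auto simp: N_def T_def)
qed

text \<open>Multiplying \<open>1 - t a\<close> by its conjugate under \<open>b \<mapsto> r - b\<close> moves the coefficient into \<open>W\<close>.\<close>

lemma regular_descend:
  assumes T: "subring T R" and N: "ideal_in T N" and W: "subring W R" "W \<subseteq> T"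
    and step: "t_step W r b" and b: "b \<in> T"
    and a: "a \<in> W" and t: "t \<in> adjoin W b" "a \<otimes> (\<one> \<ominus> t \<otimes> a) \<in> N"
  shows "\<exists>s\<in>W. a \<otimes> (\<one> \<ominus> s \<otimes> a) \<in> N"
proof -
  note T' = subring_closed[OF T] and W' = subring_closed[OF W(1)] and N' = ideal_in_closed[OF T N]
  define c where "c = b \<otimes> b \<ominus> r \<otimes> b"
  have bc: "b \<in> carrier R" "r \<in> W" "c \<in> W" using step by (auto simp: t_step_def c_def)
  obtain p q where pq: "t = p \<oplus> q \<otimes> b" "p \<in> W" "q \<in> W" using t by (auto simp: adjoin_def)
  have C: "p \<in> carrier R" "q \<in> carrier R" "a \<in> carrier R" "r \<in> carrier R" "c \<in> carrier R"
    using pq a bc W' by auto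
  define t' where "t' = p \<oplus> q \<otimes> (r \<ominus> b)"
  \<comment> \<open>\<open>m\<close> is the norm \<open>t t'\<close>, and \<open>p + p + q r\<close>
    is the trace \<open>t + t'\<close>; both lie in \<open>W\<close>, hence so does
    \<open>s\<close>.\<close>
  define m where "m = p \<otimes> p \<oplus> p \<otimes> q \<otimes> r \<ominus> q \<otimes> q \<otimes> c"
  define s where "s = p \<oplus> p \<oplus> q \<otimes> r \<ominus> m \<otimes> a"
  have tC: "t \<in> carrier R" "t' \<in> carrier R" "m \<in> carrier R"
    using pq(1) C bc(1) by (simp_all add: t'_def m_def)
  have "p \<in> T" "q \<in> T" "r \<in> T" "a \<in> T" using pq bc a W(2) by auto
  then have tT: "\<one> \<ominus> t' \<otimes> a \<in> T" using b T' by (simp add: t'_def)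
  have s: "s \<in> W" using pq bc a W' by (simp add: s_def m_def)
  have tt: "t \<otimes> t' = m" unfolding pq(1) t'_def m_def c_def using C bc(1) by algebra
  have "t \<oplus> t' = p \<oplus> p \<oplus> q \<otimes> r" unfolding pq(1) t'_def using C bc(1) by algebra
  then have s_eq: "s = t \<oplus> t' \<ominus> t \<otimes> t' \<otimes> a" by (simp add: s_def tt)
  have "a \<otimes> (\<one> \<ominus> s \<otimes> a) = a \<otimes> (\<one> \<ominus> t \<otimes> a) \<otimes> (\<one> \<ominus> t' \<otimes> a)"
    unfolding s_eq using C(3) tC(1,2) by algebra
  then have "a \<otimes> (\<one> \<ominus> s \<otimes> a) \<in> N" using t(2) N'(5) tT by simp
  then show ?thesis using s by blast
qed

section \<open>Regularity between the base ring and the t-closure\<close>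

text \<open>All intermediate \<open>W\<close> are treated at once, because the induction passes from
  \<open>W\<close> to \<open>W + W b\<close>; the radical is the same for all of them.\<close>

definition regular_over :: "'a set \<Rightarrow> 'a set \<Rightarrow> bool" where
  "regular_over A T \<longleftrightarrow> (\<forall>W. subring W R \<and> A \<subseteq> W \<and> W \<subseteq> T \<longrightarrow>
     (\<forall>a\<in>W. \<exists>t\<in>W. a \<otimes> (\<one> \<ominus> t \<otimes> a) \<in> radical_in T (conductor A T)))"

text \<open>Regularity is composed along \<open>A \<subseteq> A + A b \<subseteq> T\<close>. The
  upper stage makes \<open>a (1 - s a)\<close> nilpotent modulo \<open>J\<close>, the lower stage is
  applied to a power \<open>j\<close> of this element modulo \<open>K\<close>, and
  \<open>K J\<close> lies in the conductor of \<open>A\<close> in \<open>T\<close>.\<close>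

lemma regular_over_step:
  assumes fcp: "FCP B R" and A: "subring A R" "B \<subseteq> A" and step: "t_step A r b"
    and T: "subring T R" "A \<subseteq> T" "b \<in> T" and reg: "regular_over (adjoin A b) T"
  shows "regular_over A T"
  unfolding regular_over_def
proof (intro allI impI ballI, elim conjE)
  fix W a assume W: "subring W R" "A \<subseteq> W" "W \<subseteq> T" and a: "a \<in> W"
  define A1 where "A1 = adjoin A b"
  define J where "J = conductor A1 T"
  define K where "K = conductor A A1"
  note A' = subring_closed[OF A(1)] and W' = subring_closed[OF W(1)] and T' = subring_closed[OF T(1)]
  have b: "b \<in> carrier R" using step by (auto simp: t_step_def)
  have A1: "subring A1 R" "A \<subseteq> A1" "A1 \<subseteq> T"
    unfolding A1_def using t_step_adjoin[OF A(1) step] subset_adjoin[OF A(1) b] adjoin_least[OF T] by auto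
  have J: "ideal_in T J" unfolding J_def by (rule ideal_in_conductor[OF A1(1) T(1) A1(3)])
  have K: "ideal_in A1 K" unfolding K_def by (rule ideal_in_conductor[OF A(1) A1(1,2)])
  have N: "ideal_in T (radical_in T J)" by (rule ideal_in_radical[OF T(1) J])
  have IA: "ideal_in T (conductor A T)" by (rule ideal_in_conductor[OF A(1) T(1,2)])
  note J' = ideal_in_closed[OF T(1) J] and K' = ideal_in_closed[OF A1(1) K]
    and IA' = ideal_in_closed[OF T(1) IA]
  have stepW: "t_step W r b" by (rule t_step_mono[OF step W(2)])
  \<comment> \<open>The hypothesis concerns rings that contain \<open>b\<close>, so it is used for
    \<open>W + W b\<close>; \<open>regular_descend\<close> brings the coefficient back into
    \<open>W\<close>.\<close>
  have W1: "subring (adjoin W b) R" "A1 \<subseteq> adjoin W b" "adjoin W b \<subseteq> T" "a \<in> adjoin W b"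
    using t_step_adjoin[OF W(1) stepW] adjoin_least[OF T(1) W(3) T(3)] W(2) a
      subset_adjoin(1)[OF W(1) b] by (auto simp: A1_def adjoin_def)
  obtain t where "t \<in> adjoin W b" "a \<otimes> (\<one> \<ominus> t \<otimes> a) \<in> radical_in T J"
    using reg W1 unfolding regular_over_def J_def A1_def by blast
  then obtain s where s: "s \<in> W" "a \<otimes> (\<one> \<ominus> s \<otimes> a) \<in> radical_in T J"
    using regular_descend[OF T(1) N W(1,3) stepW T(3) a] by blast
  define v where "v = \<one> \<ominus> s \<otimes> a"
  define y where "y = a \<otimes> v"
  have vy: "v \<in> W" "y \<in> W" using s a W' by (auto simp: v_def y_def)
  obtain m0 :: nat where m0: "y [^] m0 \<in> J" using s(2) by (auto simp: radical_in_def y_def v_def)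
  have inC: "a \<in> carrier R" "s \<in> carrier R" "v \<in> carrier R" "y \<in> carrier R" using a s vy W' by auto
  \<comment> \<open>One more than \<open>m0\<close>, so that \<open>j\<close> is a multiple of
    \<open>a\<close> even if \<open>m0 = 0\<close>; this lets \<open>1 - z j\<close> be absorbed
    into the form \<open>1 - s' a\<close>.\<close>
  define j where "j = y [^] Suc m0"
  have jJ: "j \<in> J" unfolding j_def using J'(5)[OF m0, of y] vy W by auto
  have j: "j \<in> A1" "j \<in> W" "j \<in> carrier R"
    using jJ vy W' inC by (auto simp: J_def conductor_def j_def)
  obtain z where z: "z \<in> W" "j \<otimes> (\<one> \<ominus> z \<otimes> j) \<in> radical_in A1 K"
    using regular_mod_conductor_step[OF fcp A step W(1,2)] j by (auto simp: A1_def K_def)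
  define w where "w = \<one> \<ominus> z \<otimes> j"
  have zw: "z \<in> carrier R" "w \<in> W" "w \<in> carrier R" using z j W' by (auto simp: w_def)
  obtain l :: nat where l: "(j \<otimes> w) [^] l \<in> K" using z by (auto simp: radical_in_def w_def)
  \<comment> \<open>\<open>J\<close> carries \<open>T\<close> into \<open>A1\<close>, and
    \<open>K\<close> carries \<open>A1\<close> into \<open>A\<close>.\<close>
  have KJ: "k \<otimes> i \<in> conductor A T" if "k \<in> K" "i \<in> J" for k i
  proof -
    have C: "k \<in> carrier R" "i \<in> carrier R" using that K'(3) J'(3) by auto
    have "k \<otimes> i \<otimes> x \<in> A" if x: "x \<in> T" for x
    proof -
      have "i \<otimes> x \<in> A1" using \<open>i \<in> J\<close> x by (simp add: J_def conductor_def)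
      then have "k \<otimes> (i \<otimes> x) \<in> A" using \<open>k \<in> K\<close> by (simp add: K_def conductor_def)
      then show ?thesis using C T'(4)[OF x] by (simp add: m_assoc)
    qed
    moreover have "k \<otimes> i \<in> A" using that by (simp add: K_def J_def conductor_def)
    ultimately show ?thesis by (simp add: conductor_def)
  qed
  have "(j \<otimes> w) [^] l \<otimes> j \<in> conductor A T" by (rule KJ[OF l jJ])
  then have "(j \<otimes> w) [^] l \<otimes> j \<otimes> w \<in> conductor A T" using IA'(5) zw W by auto
  then have "(j \<otimes> w) [^] Suc l \<in> conductor A T" using j zw by (simp add: m_assoc)
  moreover have "y \<otimes> w \<in> T" "j \<otimes> w \<in> T" using vy zw j W W' by auto
  ultimately have "j \<otimes> w \<in> radical_in T (conductor A T)" unfolding radical_in_def by blast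
  moreover have "(y \<otimes> w) [^] Suc m0 = j \<otimes> w \<otimes> w [^] m0"
    using inC zw unfolding j_def by (simp add: nat_pow_distrib m_ac)
  moreover have "w [^] m0 \<in> T" using W'(9)[OF zw(2)] W(3) by blast
  ultimately have "(y \<otimes> w) [^] Suc m0 \<in> radical_in T (conductor A T)"
    using ideal_in_closed(5)[OF T(1) ideal_in_radical[OF T(1) IA]] by simp
  then have fin: "y \<otimes> w \<in> radical_in T (conductor A T)"
    by (rule radical_in_pow_imp[OF T(1) \<open>y \<otimes> w \<in> T\<close>])
  define h where "h = y [^] m0"
  have h: "h \<in> W" "h \<in> carrier R" using vy W' inC by (auto simp: h_def)
  \<comment> \<open>Determined by \<open>(1 - s a) (1 - z j) = 1 - s' a\<close>, where
    \<open>j = h a v\<close>.\<close>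
  define s' where "s' = s \<oplus> v \<otimes> (z \<otimes> (h \<otimes> v))"
  have "s' \<in> W" using s vy z h W' by (simp add: s'_def)
  moreover have "y \<otimes> w = a \<otimes> (\<one> \<ominus> s' \<otimes> a)"
  proof -
    have "w = \<one> \<ominus> z \<otimes> (h \<otimes> (a \<otimes> v))" by (simp add: w_def j_def h_def y_def)
    then have "y \<otimes> w = a \<otimes> (v \<ominus> v \<otimes> (z \<otimes> (h \<otimes> v)) \<otimes> a)" unfolding y_def
      using inC zw(1) h(2) by algebra
    also have "\<dots> = a \<otimes> (\<one> \<ominus> s \<otimes> a \<ominus> v \<otimes> (z \<otimes> (h \<otimes> v)) \<otimes> a)" by (simp add: v_def)
    also have "\<dots> = a \<otimes> (\<one> \<ominus> s' \<otimes> a)" unfolding s'_def using inC(1-3) zw(1) h(2) by algebra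
    finally show ?thesis .
  qed
  ultimately show "\<exists>t\<in>W. a \<otimes> (\<one> \<ominus> t \<otimes> a) \<in> radical_in T (conductor A T)" using fin by auto
qed

text \<open>A t-closed \<open>A\<close> inside \<open>T\<close> is \<open>T\<close> itself by
  minimality. Otherwise some elementary step enlarges \<open>A\<close>; it stays inside
  \<open>T\<close>, which is t-closed, and regularity descends from the larger ring.\<close>

lemma regular_over_t_closure:
  assumes fcp: "FCP B R" and B: "subring B R"
  shows "regular_over B (t_closure B R)"
proof -
  define T where "T = t_closure B R"
  have Bc: "B \<subseteq> carrier R" by (rule subringE(1)[OF B])
  note clos = t_closure_intermediate[OF ring_axioms Bc] t_closure_t_closed[OF ring_axioms Bc]
  have T: "subring T R" "B \<subseteq> T" using clos by (auto simp: T_def intermediate_rings_def)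
  have Tt: "t_closed T R" using clos by (simp add: T_def)
  have "A \<subseteq> T \<Longrightarrow> A \<in> intermediate_rings B R \<Longrightarrow> regular_over A T" for A
  proof (induction A rule: wf_induct_rule[OF FCP_wf[OF fcp]])
    case (1 A)
    then have A: "subring A R" "B \<subseteq> A" by (auto simp: intermediate_rings_def)
    show ?case
    proof (cases "t_closed A R")
      case True
      then have "A = T"
        using t_closure_least[OF ring_axioms Bc 1(3)] 1(2) by (auto simp: T_def)
      \<comment> \<open>The conductor of \<open>T\<close> in itself is \<open>T\<close>, so the
        coefficient \<open>0\<close> serves for every \<open>a\<close>.\<close>
      have "a \<otimes> (\<one> \<ominus> \<zero> \<otimes> a) \<in> radical_in T (conductor T T)" if "a \<in> T" for a
      proof -
        have "conductor T T = T" using subring_closed(6)[OF T(1)] by (auto simp: conductor_def)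
        moreover have "a \<otimes> (\<one> \<ominus> \<zero> \<otimes> a) = a"
          using that subring_closed(4)[OF T(1)] by (simp add: a_minus_def)
        moreover have "T \<subseteq> radical_in T T"
          by (rule subset_radical_in[OF T(1)]) (use subring_closed[OF T(1)] in \<open>simp add: ideal_in_def\<close>)
        ultimately show ?thesis using that by auto
      qed
      then show ?thesis
        unfolding regular_over_def \<open>A = T\<close> using subring_closed(2) by blast
    next
      case False
      then obtain b r where step: "t_step A r b" and b: "b \<notin> A"
        using t_closed_iff[OF subringE(1)[OF A(1)]] by blast
      have bT: "b \<in> T"
        using Tt t_step_mono[OF step 1(2)] t_closed_iff[OF subringE(1)[OF T(1)]] by blast
      have bc: "b \<in> carrier R" using step by (simp add: t_step_def)
      have sub: "A \<subset> adjoin A b" using subset_adjoin[OF A(1) bc] b by auto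
      have inter: "adjoin A b \<in> intermediate_rings B R"
        using t_step_adjoin[OF A(1) step] sub A(2) by (auto simp: intermediate_rings_def)
      have "regular_over (adjoin A b) T"
        by (rule 1(1)) (use sub inter 1(3) adjoin_least[OF T(1) 1(2) bT] in auto)
      then show ?thesis by (rule regular_over_step[OF fcp A step T(1) 1(2) bT])
    qed
  qed
  then show ?thesis using T B by (simp add: T_def intermediate_rings_def)
qed

section \<open>Nilpotents and idempotents modulo an ideal\<close>

text \<open>Such exponents suit the inductions below: squaring an element, or squaring the error by
  a Newton step, lowers \<open>k\<close> by one.\<close>

lemma radical_in_power_of_2:
  assumes T: "subring T R" and I: "ideal_in T I" and "x \<in> radical_in T I"
  shows "\<exists>k. x [^] ((2::nat) ^ k) \<in> I"
proof -
  obtain n :: nat where x: "x \<in> T" "x [^] n \<in> I" using assms by (auto simp: radical_in_def)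
  have "n \<le> 2 ^ n" by simp
  then have "x [^] ((2::nat) ^ n) = x [^] n \<otimes> x [^] (2 ^ n - n)"
    using x(1) subring_closed(4)[OF T] by (simp add: nat_pow_mult)
  then have "x [^] ((2::nat) ^ n) \<in> I"
    using ideal_in_closed(5)[OF T I x(2)] subring_closed(9)[OF T x(1)] by simp
  then show ?thesis by blast
qed

text \<open>If \<open>y\<close> has exponent \<open>2^(k+1)\<close>, then \<open>y^2\<close> and
  \<open>y^3\<close> have exponent \<open>2^k\<close>, because \<open>3 * 2^k \<ge> 2^(k+1)\<close>.
  By induction both lie in \<open>C\<close>, and seminormality gives \<open>y\<close>.\<close>

lemma radical_subset_seminormal:
  assumes T: "subring T R" and I: "ideal_in T I" and "I \<subseteq> C" and C: "seminormal C R"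
  shows "radical_in T I \<subseteq> C"
proof
  fix x assume x: "x \<in> radical_in T I"
  note T' = subring_closed[OF T] and I' = ideal_in_closed[OF T I]
  have "y \<in> T \<Longrightarrow> y [^] ((2::nat) ^ k) \<in> I \<Longrightarrow> y \<in> C" for y k
  proof (induction k arbitrary: y)
    case 0
    then show ?case using \<open>I \<subseteq> C\<close> T' by auto
  next
    case (Suc k)
    have yc: "y \<in> carrier R" using Suc.prems T' by simp
    have y2: "(y [^] (2::nat)) [^] ((2::nat) ^ k) \<in> I"
      using Suc.prems yc by (simp add: nat_pow_pow)
    have "(y [^] (3::nat)) [^] ((2::nat) ^ k) = y [^] ((2::nat) ^ Suc k) \<otimes> y [^] ((2::nat) ^ k)"
      using yc by (simp add: nat_pow_pow nat_pow_mult)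
    then have "(y [^] (3::nat)) [^] ((2::nat) ^ k) \<in> I"
      using I'(5)[OF Suc.prems(2)] T'(9)[OF Suc.prems(1)] by simp
    then have "y [^] (2::nat) \<in> C" "y [^] (3::nat) \<in> C"
      using Suc.IH y2 T'(9)[OF Suc.prems(1)] by auto
    then show ?case using C yc unfolding seminormal_def by blast
  qed
  moreover have "x \<in> T" using x by (simp add: radical_in_def)
  ultimately show "x \<in> C" using radical_in_power_of_2[OF T I x] by blast
qed

text \<open>Newton iteration for \<open>X\<^sup>2 - X\<close>, whose derivative is \<open>- q\<close>; it squares the error \<open>d\<close>.\<close>

lemma idempotent_newton_step:
  assumes w: "w \<in> carrier R"
  defines "d \<equiv> w \<otimes> w \<ominus> w" and "q \<equiv> \<one> \<ominus> w \<ominus> w"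
  shows "(w \<oplus> d \<otimes> q) \<otimes> (w \<oplus> d \<otimes> q) \<ominus> (w \<oplus> d \<otimes> q)
    = d \<otimes> d \<otimes> (q \<otimes> q \<ominus> (\<one> \<oplus> \<one> \<oplus> \<one> \<oplus> \<one>))"
proof -
  have dq: "d \<in> carrier R" "q \<in> carrier R" using w by (auto simp: d_def q_def)
  \<comment> \<open>As \<open>q^2 = 1 + 4 d\<close>, the element \<open>q\<close> is its own inverse
    modulo \<open>d\<close>; hence the correction \<open>d q\<close> in place of the Newton quotient
    \<open>d / q\<close>.\<close>
  have qq: "q \<otimes> q \<ominus> \<one> = d \<oplus> d \<oplus> d \<oplus> d" unfolding d_def q_def using w by algebra
  have "(w \<oplus> d \<otimes> q) \<otimes> (w \<oplus> d \<otimes> q) \<ominus> (w \<oplus> d \<otimes> q)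
      = (w \<otimes> w \<ominus> w) \<ominus> d \<otimes> q \<otimes> (\<one> \<ominus> w \<ominus> w) \<oplus> d \<otimes> q \<otimes> (d \<otimes> q)"
    using w dq by algebra
  also have "\<dots> = d \<ominus> d \<otimes> q \<otimes> q \<oplus> d \<otimes> q \<otimes> (d \<otimes> q)" by (simp add: d_def q_def)
  also have "\<dots> = d \<otimes> d \<otimes> (q \<otimes> q) \<ominus> d \<otimes> (q \<otimes> q \<ominus> \<one>)" using dq by algebra
  also have "\<dots> = d \<otimes> d \<otimes> (q \<otimes> q \<ominus> (\<one> \<oplus> \<one> \<oplus> \<one> \<oplus> \<one>))" unfolding qq using dq by algebra
  finally show ?thesis .
qed

text \<open>Induction on the exponent \<open>2^k\<close> that sends the error into \<open>I\<close>.
  For \<open>k = 0\<close> the element is idempotent modulo \<open>I\<close>, and u-closedness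
  applies. Otherwise the Newton iterate has a smaller exponent, and it differs from the element by a
  member of the radical, hence of \<open>C\<close>.\<close>

lemma idempotent_mod_radical_mem:
  assumes T: "subring T R" and I: "ideal_in T I" and U: "u_closed U R" "I \<subseteq> U"
    and C: "subring C R" "U \<subseteq> C" "radical_in T I \<subseteq> C"
    and w: "w \<in> T" "w \<otimes> w \<ominus> w \<in> radical_in T I"
  shows "w \<in> C"
proof -
  note T' = subring_closed[OF T] and I' = ideal_in_closed[OF T I]
  note N' = ideal_in_closed[OF T ideal_in_radical[OF T I]]
  have "v \<in> T \<Longrightarrow> (v \<otimes> v \<ominus> v) [^] ((2::nat) ^ k) \<in> I \<Longrightarrow> v \<in> C" for v k
  proof (induction k arbitrary: v)
    case 0
    have vc: "v \<in> carrier R" using 0 T' by simp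
    have d: "v \<otimes> v \<ominus> v \<in> I" using 0 vc by simp
    have "v \<otimes> v \<otimes> v \<ominus> v \<otimes> v = (v \<otimes> v \<ominus> v) \<otimes> v" using vc by algebra
    then have "v \<otimes> v \<otimes> v \<ominus> v \<otimes> v \<in> I" using I'(5)[OF d 0(1)] by simp
    then have "v [^] (2::nat) \<ominus> v \<in> U" "v [^] (3::nat) \<ominus> v [^] (2::nat) \<in> U"
      using U(2) d vc by (auto simp: numeral_eq_Suc)
    then have "v \<in> U" using U(1) vc unfolding u_closed_def by blast
    then show ?case using C by blast
  next
    case (Suc k)
    have vc: "v \<in> carrier R" using Suc T' by simp
    define d where "d = v \<otimes> v \<ominus> v"
    define q where "q = \<one> \<ominus> v \<ominus> v"
    define e where "e = q \<otimes> q \<ominus> (\<one> \<oplus> \<one> \<oplus> \<one> \<oplus> \<one>)"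
    have dqe: "d \<in> T" "q \<in> T" "e \<in> T" using Suc T' by (auto simp: d_def q_def e_def)
    then have dqec: "d \<in> carrier R" "q \<in> carrier R" "e \<in> carrier R" using T' by auto
    let ?v = "v \<oplus> d \<otimes> q"
    have vT: "?v \<in> T" using Suc dqe T' by simp
    have dI: "d [^] ((2::nat) ^ Suc k) \<in> I" using Suc by (simp add: d_def)
    have "(?v \<otimes> ?v \<ominus> ?v) [^] ((2::nat) ^ k) = ((d [^] (2::nat)) \<otimes> e) [^] ((2::nat) ^ k)"
      using idempotent_newton_step[OF vc] dqec by (simp add: d_def q_def e_def numeral_2_eq_2)
    also have "\<dots> = d [^] ((2::nat) ^ Suc k) \<otimes> e [^] ((2::nat) ^ k)"
      using dqec by (simp add: nat_pow_distrib nat_pow_pow)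
    also have "\<dots> \<in> I" by (rule I'(5)[OF dI T'(9)[OF dqe(3)]])
    finally have "?v \<in> C" by (rule Suc.IH[OF vT])
    moreover have "d \<in> radical_in T I" using dI dqe unfolding radical_in_def by blast
    then have "d \<otimes> q \<in> C" using N'(5) dqe C(3) by blast
    ultimately have "?v \<ominus> d \<otimes> q \<in> C" by (rule subring_closed(8)[OF C(1)])
    moreover have "?v \<ominus> d \<otimes> q = v" using vc dqec by algebra
    ultimately show ?case by simp
  qed
  then show ?thesis using radical_in_power_of_2[OF T I w(2)] w(1) by blast
qed

section \<open>A criterion for absorbing elementary steps\<close>

text \<open>The decomposition is \<open>b = t (b c) + (g b1 + r z)\<close>: \<open>b c\<close> lies
  in \<open>C\<close> by hypothesis, \<open>g b1\<close> lies in \<open>N\<close>, and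
  \<open>z\<close> is idempotent modulo \<open>N\<close>.\<close>

lemma t_step_mem_of_regular:
  assumes T: "subring T R" and I: "ideal_in T I" and C: "subring C R" "C \<subseteq> T"
  defines "N \<equiv> radical_in T I"
  assumes NC: "N \<subseteq> C" and regular: "\<And>a. a \<in> C \<Longrightarrow> \<exists>t\<in>C. a \<otimes> (\<one> \<ominus> t \<otimes> a) \<in> N"
    and idem: "\<And>w. w \<in> T \<Longrightarrow> w \<otimes> w \<ominus> w \<in> N \<Longrightarrow> w \<in> C"
    and step: "t_step C r b" and b: "b \<in> T"
  shows "b \<in> C"
proof -
  note T' = subring_closed[OF T] and C' = subring_closed[OF C(1)]
  note N' = ideal_in_closed[OF T ideal_in_radical[OF T I], folded N_def]
  define c where "c = b \<otimes> b \<ominus> r \<otimes> b"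
  have rc: "r \<in> C" "c \<in> C" "b \<otimes> c \<in> C" using step by (auto simp: t_step_def c_def)
  obtain t where t: "t \<in> C" "c \<otimes> (\<one> \<ominus> t \<otimes> c) \<in> N" using regular[OF rc(2)] by blast
  obtain s where s: "s \<in> C" "r \<otimes> (\<one> \<ominus> s \<otimes> r) \<in> N" using regular[OF rc(1)] by blast
  have inT: "r \<in> T" "c \<in> T" "t \<in> T" "s \<in> T" using rc t s C by auto
  have inC: "r \<in> carrier R" "c \<in> carrier R" "t \<in> carrier R" "s \<in> carrier R" "b \<in> carrier R"
    using inT b T' by auto
  \<comment> \<open>\<open>f\<close> kills \<open>c\<close> modulo \<open>N\<close>, and
    \<open>g\<close> kills \<open>r\<close>. Hence \<open>b1 = b f\<close> satisfies
    \<open>b1^2 = r b1\<close> modulo \<open>N\<close>.\<close>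
  define f where "f = \<one> \<ominus> t \<otimes> c"
  define g where "g = \<one> \<ominus> s \<otimes> r"
  define b1 where "b1 = b \<otimes> f"
  have fg: "f \<in> T" "g \<in> T" "b1 \<in> T" using inT b T' by (auto simp: f_def g_def b1_def)
  then have fgc: "f \<in> carrier R" "g \<in> carrier R" "b1 \<in> carrier R" using T' by auto
  define n where "n = b1 \<otimes> b1 \<ominus> r \<otimes> b1"
  have "n = f \<otimes> (b \<otimes> b \<otimes> (\<one> \<ominus> t \<otimes> c) \<ominus> r \<otimes> b)"
    unfolding n_def b1_def using inC fgc by (simp add: f_def[symmetric]) algebra
  also have "\<dots> = f \<otimes> ((b \<otimes> b \<ominus> r \<otimes> b) \<ominus> b \<otimes> b \<otimes> (t \<otimes> c))" using inC fgc by algebra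
  also have "\<dots> = f \<otimes> (c \<ominus> b \<otimes> b \<otimes> (t \<otimes> c))" by (simp add: c_def)
  also have "\<dots> = c \<otimes> f \<otimes> (\<one> \<ominus> b \<otimes> b \<otimes> t)" using inC fgc by algebra
  finally have nN: "n \<in> N" using N'(5)[OF t(2), folded f_def] inT b T' by simp
  then have nc: "n \<in> carrier R" using N' by blast
  have sq: "b1 \<otimes> b1 = n \<oplus> r \<otimes> b1" unfolding n_def using inC fgc by algebra
  \<comment> \<open>Modulo \<open>N\<close> this square is \<open>(r g) (g b1)\<close>, which
    vanishes; \<open>N\<close> is a radical, so it contains \<open>g b1\<close>.\<close>
  have "g \<otimes> b1 \<otimes> (g \<otimes> b1) = g \<otimes> g \<otimes> (b1 \<otimes> b1)" using fgc by algebra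
  also have "\<dots> = n \<otimes> (g \<otimes> g) \<oplus> r \<otimes> g \<otimes> (g \<otimes> b1)" unfolding sq using inC fgc nc by algebra
  also have "\<dots> \<in> N"
    by (intro N'(4) N'(5)[OF nN] N'(5)[OF s(2)[folded g_def]]) (use fg T' in simp_all)
  finally have xN: "g \<otimes> b1 \<in> N"
    unfolding N_def by (rule radical_in_square_imp[OF T, rotated]) (use fg T' in simp)
  \<comment> \<open>\<open>z\<close> stands for \<open>b1 / r\<close>, with \<open>s\<close> as the
    inverse of \<open>r\<close> on the part where \<open>r\<close> is invertible.\<close>
  define z where "z = s \<otimes> b1"
  have z: "z \<in> T" "z \<in> carrier R" using inT fg inC fgc T' by (auto simp: z_def)
  have "z \<otimes> z \<ominus> z = s \<otimes> s \<otimes> (b1 \<otimes> b1) \<ominus> s \<otimes> b1" unfolding z_def using inC fgc by algebra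
  also have "\<dots> = n \<otimes> (s \<otimes> s) \<ominus> ((\<one> \<ominus> s \<otimes> r) \<otimes> b1) \<otimes> s"
    unfolding sq using inC fgc nc by algebra
  also have "\<dots> \<in> N"
    by (intro N'(8) N'(5)[OF nN] N'(5)[OF xN[unfolded g_def]]) (use inT T' in simp_all)
  finally have "z \<in> C" using idem z by blast
  have "b = t \<otimes> (b \<otimes> c) \<oplus> b \<otimes> (\<one> \<ominus> t \<otimes> c)" using inC by algebra
  also have "b \<otimes> (\<one> \<ominus> t \<otimes> c) = b1" by (simp add: b1_def f_def)
  also have "b1 = (\<one> \<ominus> s \<otimes> r) \<otimes> b1 \<oplus> r \<otimes> z" unfolding z_def using inC fgc by algebra
  also have "(\<one> \<ominus> s \<otimes> r) \<otimes> b1 = g \<otimes> b1" by (simp add: g_def)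
  finally have "b = t \<otimes> (b \<otimes> c) \<oplus> (g \<otimes> b1 \<oplus> r \<otimes> z)" .
  moreover have "t \<otimes> (b \<otimes> c) \<oplus> (g \<otimes> b1 \<oplus> r \<otimes> z) \<in> C"
    using C'(6)[OF t(1) rc(3)] C'(6)[OF rc(1) \<open>z \<in> C\<close>] NC xN C'(5) by blast
  ultimately show ?thesis by simp
qed

section \<open>Comparison of the three closures\<close>

text \<open>Two instances of the t-closed condition: \<open>r = 0\<close> gives seminormality and
  \<open>r = 1\<close> gives u-closedness.\<close>

lemma t_closed_imp_seminormal_u_closed:
  assumes A: "subring A R" and t: "t_closed A R"
  shows "seminormal A R" "u_closed A R"
proof -
  note A' = subring_closed[OF A]
  have "b \<in> A" if "b \<in> carrier R" "b [^] (2::nat) \<in> A" "b [^] (3::nat) \<in> A" for b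
  proof -
    have "\<exists>r\<in>A. b [^] (2::nat) \<ominus> r \<otimes> b \<in> A \<and> b [^] (3::nat) \<ominus> r \<otimes> b [^] (2::nat) \<in> A"
      using that A'(2) by (intro bexI[of _ \<zero>]) (simp_all add: a_minus_def)
    then show ?thesis using t that(1) unfolding t_closed_def by blast
  qed
  then show "seminormal A R" by (simp add: seminormal_def)
  have "b \<in> A" if "b \<in> carrier R" "b [^] (2::nat) \<ominus> b \<in> A"
    "b [^] (3::nat) \<ominus> b [^] (2::nat) \<in> A" for b
  proof -
    have "\<exists>r\<in>A. b [^] (2::nat) \<ominus> r \<otimes> b \<in> A \<and> b [^] (3::nat) \<ominus> r \<otimes> b [^] (2::nat) \<in> A"
      using that A'(3) by (intro bexI[of _ \<one>]) simp_all
    then show ?thesis using t that(1) unfolding t_closed_def by blast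
  qed
  then show "u_closed A R" by (simp add: u_closed_def)
qed

lemma compositum_least:
  assumes "subring T R" "A \<subseteq> T" "B \<subseteq> T"
  shows "compositum R A B \<subseteq> T"
  unfolding compositum_def by (rule generate_ring_min_subring1) (use assms subringE(1)[OF assms(1)] in auto)

text \<open>One inclusion holds because a t-closed ring is seminormal and u-closed. For the other,
  minimality of the t-closure reduces the claim to t-closedness of the compositum
  \<open>C\<close>.\<close>

lemma compositum_eq_t_closure:
  assumes fcp: "FCP B R" and B: "subring B R"
  shows "compositum R (u_closure B R) (seminormalization B R) = t_closure B R"
proof
  have Bc: "B \<subseteq> carrier R" by (rule subringE(1)[OF B])
  define U where "U = u_closure B R"
  define P where "P = seminormalization B R"
  define T where "T = t_closure B R"
  define C where "C = compositum R U P"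
  have T: "subring T R" "B \<subseteq> T" "t_closed T R" "T \<in> intermediate_rings B R"
    using t_closure_intermediate[OF ring_axioms Bc] t_closure_t_closed[OF ring_axioms Bc]
    by (auto simp: T_def intermediate_rings_def)
  have U: "subring U R" "B \<subseteq> U" "u_closed U R"
    using u_closure_intermediate[OF ring_axioms Bc] u_closure_u_closed[OF ring_axioms Bc]
    by (auto simp: U_def intermediate_rings_def)
  have P: "subring P R" "B \<subseteq> P" "seminormal P R"
    using seminormalization_intermediate[OF ring_axioms Bc] seminormalization_seminormal[OF ring_axioms Bc]
    by (auto simp: P_def intermediate_rings_def)
  have "U \<subseteq> T" "P \<subseteq> T"
    using t_closed_imp_seminormal_u_closed[OF T(1,3)] T(4) u_closure_least[OF ring_axioms Bc]
      seminormalization_least[OF ring_axioms Bc] by (auto simp: U_def P_def)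
  then have CT: "C \<subseteq> T" unfolding C_def by (rule compositum_least[OF T(1)])
  then show "compositum R (u_closure B R) (seminormalization B R) \<subseteq> t_closure B R"
    by (simp add: C_def U_def P_def T_def)
  have UPc: "U \<union> P \<subseteq> carrier R" using subringE(1)[OF U(1)] subringE(1)[OF P(1)] by auto
  have C: "subring C R" "U \<subseteq> C" "P \<subseteq> C"
    unfolding C_def compositum_def
    using generate_ring_is_subring[OF UPc] by (auto intro: generate_ring.incl)
  define J where "J = conductor B T"
  have J: "ideal_in T J" unfolding J_def by (rule ideal_in_conductor[OF B T(1,2)])
  have JB: "J \<subseteq> B" by (auto simp: J_def conductor_def)
  have "radical_in T J \<subseteq> P"
    using radical_subset_seminormal[OF T(1) J _ P(3)] JB P(2) by blast
  then have NC: "radical_in T J \<subseteq> C" using C(3) by blast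
  have reg: "\<exists>t\<in>C. a \<otimes> (\<one> \<ominus> t \<otimes> a) \<in> radical_in T J" if "a \<in> C" for a
    using regular_over_t_closure[OF fcp B] that C(1,2) CT U(2)
    unfolding regular_over_def J_def T_def by blast
  have idem: "w \<in> C" if "w \<in> T" "w \<otimes> w \<ominus> w \<in> radical_in T J" for w
    using idempotent_mod_radical_mem[OF T(1) J U(3) _ C(1,2) NC that] JB U(2) by blast
  have "b \<in> C" if step: "t_step C r b" for r b
  proof -
    \<comment> \<open>The t-closed ring \<open>T\<close> absorbs every elementary step over its
      subring \<open>C\<close>.\<close>
    have "b \<in> T"
      using T(3) t_step_mono[OF step CT] t_closed_iff[OF subringE(1)[OF T(1)]] by blast
    then show ?thesis
      using t_step_mem_of_regular[OF T(1) J C(1) CT NC reg idem step] by blast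
  qed
  then have "t_closed C R" using t_closed_iff[OF subringE(1)[OF C(1)]] by blast
  moreover have "C \<in> intermediate_rings B R" using C U by (auto simp: intermediate_rings_def)
  ultimately show "t_closure B R \<subseteq> compositum R (u_closure B R) (seminormalization B R)"
    using t_closure_least[OF ring_axioms Bc] by (auto simp: C_def U_def P_def)
qed

text \<open>If \<open>B\<close> is seminormal and u-closed, it contains both closures, hence their
  compositum, which is the t-closure.\<close>

lemma t_closed_iff_seminormal_u_closed:
  assumes fcp: "FCP B R" and B: "subring B R"
  shows "t_closed B R \<longleftrightarrow> seminormal B R \<and> u_closed B R"
proof
  assume "t_closed B R"
  then show "seminormal B R \<and> u_closed B R" using t_closed_imp_seminormal_u_closed[OF B] by blast
next
  assume su: "seminormal B R \<and> u_closed B R"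
  have Bc: "B \<subseteq> carrier R" by (rule subringE(1)[OF B])
  have BB: "B \<in> intermediate_rings B R" using B by (simp add: intermediate_rings_def)
  have "t_closure B R \<subseteq> B"
    unfolding compositum_eq_t_closure[OF assms, symmetric]
    using su BB by (intro compositum_least[OF B] u_closure_least[OF ring_axioms Bc]
      seminormalization_least[OF ring_axioms Bc]) auto
  then have "t_closure B R = B"
    using t_closure_intermediate[OF ring_axioms Bc] by (auto simp: intermediate_rings_def)
  then show "t_closed B R" using t_closure_t_closed[OF ring_axioms Bc] by simp
qed

end

theorem theorem5p8:
  fixes S :: "('a, 'm) ring_scheme" and R :: "'a set"
  assumes "cring S" and "subring R S" and "R \<subset> carrier S"
    and "integral_extension R S" and "FCP R S"
  shows "compositum S (u_closure R S) (seminormalization R S) = t_closure R S \<and>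
    (t_closed R S \<longleftrightarrow> seminormal R S \<and> u_closed R S)"
  using cring.compositum_eq_t_closure[OF assms(1,5,2)]
    cring.t_closed_iff_seminormal_u_closed[OF assms(1,5,2)] by blast

end
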